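(* Let $\mathbb{T}$ be a time scale, $a,b\in\mathbb{T}$ with $a<b$, $t\in(a,b]_{\mathbb{T}}$, and $0\le\alpha\le 1$. Let $w,f,g\in C([a,b]_{\mathbb{T}},\mathbb{R})$ be diamond-$\alpha$ integrable functions and let $K:[a,b]_{\mathbb{T}}\times[a,b]_{\mathbb{T}}\to[0,\infty)$ be a nonnegative kernel. Assume that all the integrals appearing below exist and are finite. If $\delta\in[0,1]$, then, with $\beta=\min\{1-\delta,\delta\}$ and $\gamma=\max\{1-\delta,\delta\}$, \[ \begin{aligned} &2\beta\Big[\mathcal{I}_{K}^{\alpha}(|w||f|^2)(t)\,\mathcal{I}_{K}^{\alpha}(|w||g|^2)(t)-\big(\mathcal{I}_{K}^{\alpha}(|w||f||g|)(t)\big)^2\Big]\\ &\leq \mathcal{I}_{K}^{\alpha}(|w||f|^2)(t)\,\mathcal{I}_{K}^{\alpha}(|w||g|^2)(t)\\ &\quad-\mathcal{I}_{K}^{\alpha}\big(|w||f|^{2(1-\delta)}|g|^{2\delta}\big)(t)\,\mathcal{I}_{K}^{\alpha}\big(|w||f|^{2\delta}|g|^{2(1-\delta)}\big)(t)\\ &\leq 2\gamma\Big[\mathcal{I}_{K}^{\alpha}(|w||f|^2)(t)\,\mathcal{I}_{K}^{\alpha}(|w||g|^2)(t)-\big(\mathcal{I}_{K}^{\alpha}(|w||f||g|)(t)\big)^2\Big]. \end{aligned} \]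
   Context: A time scale $\mathbb{T}$ is a nonempty closed subset of $\mathbb{R}$. For $a,b\in\mathbb{T}$, $[a,b]_{\mathbb{T}}=[a,b]\cap\mathbb{T}$ and $(a,b]_{\mathbb{T}}=(a,b]\cap\mathbb{T}$. For $0\le\alpha\le1$ and $h$ delta and nabla integrable on $[a,b]_{\mathbb{T}}$, the diamond-$\alpha$ integral is \[ \int_a^b h(s)\diamond_\alpha s=\alpha\int_a^b h(s)\,\Delta s+(1-\alpha)\int_a^b h(s)\,\nabla s, \] where $\int\cdot\,\Delta s$ and $\int\cdot\,\nabla s$ are the usual delta and nabla integrals of time scale calculus. For a nonnegative kernel $K:[a,b]_{\mathbb{T}}\times[a,b]_{\mathbb{T}}\to[0,\infty)$ and a suitable function $h:[a,b]_{\mathbb{T}}\to\mathbb{R}$, the kernel-type diamond-$\alpha$ integral operator is \[ \mathcal{I}_{K}^{\alpha}h(t)=\int_a^t K(t,s)h(s)\diamond_\alpha s, \] provided that the integral exists and is finite. An expression such as $|w||f|^2$ denotes the function $s\mapsto|w(s)||f(s)|^2$. Convention: $x^0=1$ for all $x\ge0$. *)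

theory Defs
  imports "HOL-Analysis.Analysis"
begin

definition time_scale :: "real set \<Rightarrow> bool" where
  "time_scale T \<longleftrightarrow> closed T \<and> T \<noteq> {}"

text \<open>
  The delta and nabla integrals are taken in the Lebesgue sense: the delta (nabla) measure of a
  time scale is the completed extension of the length \<open>d - c\<close> of the time-scale intervals
  \<open>[c, d)\<close> (respectively \<open>(c, d]\<close>), and the integral from \<open>a\<close> to \<open>b\<close> is the Lebesgue integral
  over \<open>[a, b)\<close> (respectively \<open>(a, b]\<close>).  Every bounded Riemann delta (nabla) integrable function
  is also integrable in this sense, with the same integral; unbounded kernels are covered as well.
\<close>

definition delta_measure :: "real set \<Rightarrow> real measure" where
  "delta_measure T = completion
     (extend_measure T {(c, d). c \<in> T \<and> d \<in> T \<and> c \<le> d}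
        (\<lambda>(c, d). {c..<d} \<inter> T) (\<lambda>(c, d). ennreal (d - c)))"

definition nabla_measure :: "real set \<Rightarrow> real measure" where
  "nabla_measure T = completion
     (extend_measure T {(c, d). c \<in> T \<and> d \<in> T \<and> c \<le> d}
        (\<lambda>(c, d). {c<..d} \<inter> T) (\<lambda>(c, d). ennreal (d - c)))"

definition delta_integrable :: "real set \<Rightarrow> real \<Rightarrow> real \<Rightarrow> (real \<Rightarrow> real) \<Rightarrow> bool" where
  "delta_integrable T a b h \<longleftrightarrow> set_integrable (delta_measure T) ({a..<b} \<inter> T) h"

definition nabla_integrable :: "real set \<Rightarrow> real \<Rightarrow> real \<Rightarrow> (real \<Rightarrow> real) \<Rightarrow> bool" where
  "nabla_integrable T a b h \<longleftrightarrow> set_integrable (nabla_measure T) ({a<..b} \<inter> T) h"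

definition delta_integral :: "real set \<Rightarrow> real \<Rightarrow> real \<Rightarrow> (real \<Rightarrow> real) \<Rightarrow> real" where
  "delta_integral T a b h = set_lebesgue_integral (delta_measure T) ({a..<b} \<inter> T) h"

definition nabla_integral :: "real set \<Rightarrow> real \<Rightarrow> real \<Rightarrow> (real \<Rightarrow> real) \<Rightarrow> real" where
  "nabla_integral T a b h = set_lebesgue_integral (nabla_measure T) ({a<..b} \<inter> T) h"

text \<open>
  Diamond integrability asks for both integrals whatever the parameter \<open>\<alpha>\<close> is, also for
  \<open>\<alpha> = 0\<close> and \<open>\<alpha> = 1\<close>.  The limits of integration are meant to satisfy \<open>a \<le> b\<close>.
\<close>

definition diamond_integrable :: "real set \<Rightarrow> real \<Rightarrow> real \<Rightarrow> (real \<Rightarrow> real) \<Rightarrow> bool" where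
  "diamond_integrable T a b h \<longleftrightarrow> delta_integrable T a b h \<and> nabla_integrable T a b h"

definition diamond_integral ::
    "real set \<Rightarrow> real \<Rightarrow> real \<Rightarrow> real \<Rightarrow> (real \<Rightarrow> real) \<Rightarrow> real" where
  "diamond_integral T \<alpha> a b h = \<alpha> * delta_integral T a b h + (1 - \<alpha>) * nabla_integral T a b h"

definition kernel_integrable ::
    "real set \<Rightarrow> real \<Rightarrow> (real \<Rightarrow> real \<Rightarrow> real) \<Rightarrow> (real \<Rightarrow> real) \<Rightarrow> real \<Rightarrow> bool" where
  "kernel_integrable T a K h t \<longleftrightarrow> diamond_integrable T a t (\<lambda>s. K t s * h s)"

definition kernel_operator ::
    "real set \<Rightarrow> real \<Rightarrow> real \<Rightarrow> (real \<Rightarrow> real \<Rightarrow> real) \<Rightarrow> (real \<Rightarrow> real) \<Rightarrow> real \<Rightarrow> real" where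
  "kernel_operator T \<alpha> a K h t = diamond_integral T \<alpha> a t (\<lambda>s. K t s * h s)"

text \<open>Real powers with \<open>x\<^sup>0 = 1\<close> for all \<open>x \<ge> 0\<close>; the library has \<open>0 powr 0 = 0\<close>.\<close>

definition rpow :: "real \<Rightarrow> real \<Rightarrow> real" where
  "rpow x p = (if p = 0 then 1 else x powr p)"

text \<open>
  \<^const>\<open>extend_measure\<close> falls back to the zero measure if the given set function has no extension
  to a measure.  The following two facts show that this does not happen here.  The extension is
  the image of Lebesgue measure under the map sending a real number to the nearest point of the
  time scale on its left (respectively right).
\<close>

lemma emeasure_delta_measure_interval:
  assumes T: "time_scale T" and cd: "c \<in> T" "d \<in> T" "c \<le> d"
  shows "emeasure (delta_measure T) ({c..<d} \<inter> T) = ennreal (d - c)"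
proof -
  let ?I = "{(c, d). c \<in> T \<and> d \<in> T \<and> c \<le> d}"
  let ?G = "\<lambda>(c, d). {c..<d} \<inter> T"
  define M where "M = extend_measure T ?I ?G (\<lambda>(c, d). ennreal (d - c))"
  define S where "S = {x. \<exists>s\<in>T. s \<le> x}"
  define g where "g x = Sup (T \<inter> {..x})" for x
  have GT: "?G ` ?I \<subseteq> Pow T" by auto
  have sM: "sets M = sigma_sets T (?G ` ?I)"
    unfolding M_def by (rule sets_extend_measure[OF GT])
  have gT: "g x \<in> T" "g x \<le> x" if "x \<in> S" for x
  proof -
    have "g x \<in> T \<inter> {..x}" unfolding g_def
      using that T by (intro closed_contains_Sup) (auto simp: S_def time_scale_def)
    then show "g x \<in> T" "g x \<le> x" by auto
  qed
  have g_ge: "s \<le> g x" if "s \<in> T" "s \<le> x" for s x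
    unfolding g_def using that by (intro cSup_upper) auto
  have pre: "g -` ({p..<q} \<inter> T) \<inter> S = {p..<q}" if "p \<in> T" "q \<in> T" for p q
  proof (intro set_eqI iffI)
    fix x assume "x \<in> g -` ({p..<q} \<inter> T) \<inter> S"
    then have "p \<le> g x" "g x < q" "x \<in> S" by auto
    then show "x \<in> {p..<q}"
      using gT(2)[of x] g_ge[OF that(2), of x] by (cases "q \<le> x") auto
  next
    fix x assume x: "x \<in> {p..<q}"
    then have "x \<in> S" using that by (auto simp: S_def)
    then show "x \<in> g -` ({p..<q} \<inter> T) \<inter> S"
      using gT[of x] g_ge[OF that(1), of x] x by auto
  qed
  have S: "S \<in> sets borel"
  proof (rule real_interval_borel_measurable)
    show "is_interval S"
      unfolding is_interval_1
    proof (intro ballI allI impI)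
      fix x y z assume "x \<in> S" "y \<in> S" "x \<le> z \<and> z \<le> y"
      then show "z \<in> S" unfolding S_def by (blast intro: order_trans)
    qed
  qed
  define N where "N = restrict_space lborel S"
  have gm: "g \<in> measurable N M"
  proof (rule measurable_sigma_sets[OF sM GT])
    show "g \<in> space N \<rightarrow> T" using gT by (auto simp: N_def space_restrict_space)
    fix A assume "A \<in> ?G ` ?I"
    then obtain p q where pq: "p \<in> T" "q \<in> T" "A = {p..<q} \<inter> T" by auto
    have "g -` A \<inter> space N = {p..<q}"
      using pre[OF pq(1,2)] unfolding N_def space_restrict_space pq(3) by simp
    moreover have "{p..<q} \<subseteq> S" using pq by (auto simp: S_def)
    ultimately show "g -` A \<inter> space N \<in> sets N"
      using S by (auto simp: N_def sets_restrict_space_iff)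
  qed
  have "emeasure M (?G (c, d)) = (\<lambda>(c, d). ennreal (d - c)) (c, d)"
  proof (rule emeasure_extend_measure[OF M_def, where \<mu>' = "emeasure (distr N M g)"])
    fix i assume "i \<in> ?I"
    then obtain p q where pq: "p \<in> T" "q \<in> T" "p \<le> q" "i = (p, q)" by auto
    have "{p..<q} \<inter> T \<in> sets M" unfolding sM using pq by (intro sigma_sets.Basic) auto
    then have "emeasure (distr N M g) ({p..<q} \<inter> T) = emeasure N {p..<q}"
      using pre[OF pq(1,2)] emeasure_distr[OF gm]
      by (simp add: space_restrict_space N_def del: vimage_Int)
    also have "\<dots> = emeasure lborel {p..<q}" unfolding N_def
      using S pq by (intro emeasure_restrict_space) (auto simp: S_def)
    finally show "emeasure (distr N M g) (?G i) = (\<lambda>(c, d). ennreal (d - c)) i"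
      using pq by simp
  next
    show "positive (sets M) (emeasure (distr N M g))"
      by (metis emeasure_positive sets_distr)
    show "countably_additive (sets M) (emeasure (distr N M g))"
      by (metis emeasure_countably_additive sets_distr)
  qed (use GT cd in auto)
  moreover have "{c..<d} \<inter> T \<in> sets M" unfolding sM using cd by (intro sigma_sets.Basic) auto
  ultimately show ?thesis
    by (simp add: delta_measure_def M_def[symmetric])
qed

lemma emeasure_nabla_measure_interval:
  assumes T: "time_scale T" and cd: "c \<in> T" "d \<in> T" "c \<le> d"
  shows "emeasure (nabla_measure T) ({c<..d} \<inter> T) = ennreal (d - c)"
proof -
  let ?I = "{(c, d). c \<in> T \<and> d \<in> T \<and> c \<le> d}"
  let ?G = "\<lambda>(c, d). {c<..d} \<inter> T"
  define M where "M = extend_measure T ?I ?G (\<lambda>(c, d). ennreal (d - c))"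
  define S where "S = {x. \<exists>s\<in>T. x \<le> s}"
  define g where "g x = Inf (T \<inter> {x..})" for x
  have GT: "?G ` ?I \<subseteq> Pow T" by auto
  have sM: "sets M = sigma_sets T (?G ` ?I)"
    unfolding M_def by (rule sets_extend_measure[OF GT])
  have gT: "g x \<in> T" "x \<le> g x" if "x \<in> S" for x
  proof -
    have "g x \<in> T \<inter> {x..}" unfolding g_def
      using that T by (intro closed_contains_Inf) (auto simp: S_def time_scale_def)
    then show "g x \<in> T" "x \<le> g x" by auto
  qed
  have g_le: "g x \<le> s" if "s \<in> T" "x \<le> s" for s x
    unfolding g_def using that by (intro cInf_lower) auto
  have pre: "g -` ({p<..q} \<inter> T) \<inter> S = {p<..q}" if "p \<in> T" "q \<in> T" for p q
  proof (intro set_eqI iffI)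
    fix x assume "x \<in> g -` ({p<..q} \<inter> T) \<inter> S"
    then have "p < g x" "g x \<le> q" "x \<in> S" by auto
    then show "x \<in> {p<..q}"
      using gT(2)[of x] g_le[OF that(1), of x] by (cases "x \<le> p") auto
  next
    fix x assume x: "x \<in> {p<..q}"
    then have "x \<in> S" using that by (auto simp: S_def)
    then show "x \<in> g -` ({p<..q} \<inter> T) \<inter> S"
      using gT[of x] g_le[OF that(2), of x] x by auto
  qed
  have S: "S \<in> sets borel"
  proof (rule real_interval_borel_measurable)
    show "is_interval S"
      unfolding is_interval_1
    proof (intro ballI allI impI)
      fix x y z assume "x \<in> S" "y \<in> S" "x \<le> z \<and> z \<le> y"
      then show "z \<in> S" unfolding S_def by (blast intro: order_trans)
    qed
  qed
  define N where "N = restrict_space lborel S"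
  have gm: "g \<in> measurable N M"
  proof (rule measurable_sigma_sets[OF sM GT])
    show "g \<in> space N \<rightarrow> T" using gT by (auto simp: N_def space_restrict_space)
    fix A assume "A \<in> ?G ` ?I"
    then obtain p q where pq: "p \<in> T" "q \<in> T" "A = {p<..q} \<inter> T" by auto
    have "g -` A \<inter> space N = {p<..q}"
      using pre[OF pq(1,2)] unfolding N_def space_restrict_space pq(3) by simp
    moreover have "{p<..q} \<subseteq> S" using pq by (auto simp: S_def)
    ultimately show "g -` A \<inter> space N \<in> sets N"
      using S by (auto simp: N_def sets_restrict_space_iff)
  qed
  have "emeasure M (?G (c, d)) = (\<lambda>(c, d). ennreal (d - c)) (c, d)"
  proof (rule emeasure_extend_measure[OF M_def, where \<mu>' = "emeasure (distr N M g)"])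
    fix i assume "i \<in> ?I"
    then obtain p q where pq: "p \<in> T" "q \<in> T" "p \<le> q" "i = (p, q)" by auto
    have "{p<..q} \<inter> T \<in> sets M" unfolding sM using pq by (intro sigma_sets.Basic) auto
    then have "emeasure (distr N M g) ({p<..q} \<inter> T) = emeasure N {p<..q}"
      using pre[OF pq(1,2)] emeasure_distr[OF gm]
      by (simp add: space_restrict_space N_def del: vimage_Int)
    also have "\<dots> = emeasure lborel {p<..q}" unfolding N_def
      using S pq by (intro emeasure_restrict_space) (auto simp: S_def)
    finally show "emeasure (distr N M g) (?G i) = (\<lambda>(c, d). ennreal (d - c)) i"
      using pq by simp
  next
    show "positive (sets M) (emeasure (distr N M g))"
      by (metis emeasure_positive sets_distr)
    show "countably_additive (sets M) (emeasure (distr N M g))"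
      by (metis emeasure_countably_additive sets_distr)
  qed (use GT cd in auto)
  moreover have "{c<..d} \<inter> T \<in> sets M" unfolding sM using cd by (intro sigma_sets.Basic) auto
  ultimately show ?thesis
    by (simp add: nabla_measure_def M_def[symmetric])
qed

end

theory Submission
  imports Defs
begin

text \<open>
  The diamond-\<open>\<alpha>\<close> integral is a positive linear functional, so an inequality
  \<open>0 \<le> \<Sum>i. c i * u i s * v i r\<close> may be integrated first in \<open>s\<close> and then in \<open>r\<close>, which replaces
  every function by its integral; no product measure is needed.  The pointwise inequality is the
  two-sided Kittaneh--Manasrah refinement of Young's inequality
  \<open>\<beta> (x - y)\<^sup>2 \<le> (1 - \<delta>) x\<^sup>2 + \<delta> y\<^sup>2 - x\<^bsup>2(1-\<delta>)\<^esup> y\<^bsup>2\<delta>\<^esup> \<le> \<gamma> (x - y)\<^sup>2\<close>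
  at \<open>x = \<bar>f s\<bar> \<bar>g r\<bar>\<close> and \<open>y = \<bar>f r\<bar> \<bar>g s\<bar>\<close>.
\<close>

lemma rpow_mult: "0 \<le> x \<Longrightarrow> 0 \<le> y \<Longrightarrow> rpow (x * y) p = rpow x p * rpow y p"
  by (simp add: rpow_def powr_mult)

lemma rpow_two: "0 \<le> x \<Longrightarrow> rpow x 2 = x\<^sup>2"
  by (cases "x = 0") (auto simp: rpow_def powr_numeral)

lemma diamond_integral_sum:
  assumes "\<And>i. i \<in> J \<Longrightarrow> diamond_integrable T a b (h i)"
  shows "diamond_integral T \<alpha> a b (\<lambda>s. \<Sum>i\<in>J. c i * h i s)
    = (\<Sum>i\<in>J. c i * diamond_integral T \<alpha> a b (h i))"
proof -
  have "delta_integral T a b (\<lambda>s. \<Sum>i\<in>J. c i * h i s) = (\<Sum>i\<in>J. c i * delta_integral T a b (h i))"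
    using assms
    unfolding diamond_integrable_def delta_integrable_def set_integrable_def
      delta_integral_def set_lebesgue_integral_def
    by (simp add: sum_distrib_left mult.left_commute integral_sum)
  moreover have
    "nabla_integral T a b (\<lambda>s. \<Sum>i\<in>J. c i * h i s) = (\<Sum>i\<in>J. c i * nabla_integral T a b (h i))"
    using assms
    unfolding diamond_integrable_def nabla_integrable_def set_integrable_def
      nabla_integral_def set_lebesgue_integral_def
    by (simp add: sum_distrib_left mult.left_commute integral_sum)
  ultimately show ?thesis
    by (simp add: diamond_integral_def sum_distrib_left sum.distrib distrib_left mult.left_commute)
qed

text \<open>Both half-open ranges of integration lie in \<open>{a..b}\<close>, and both weights
  \<alpha> and 1 - \<alpha> are nonnegative.\<close>

lemma diamond_integral_nonneg:
  assumes "0 \<le> \<alpha>" "\<alpha> \<le> 1" "\<And>s. s \<in> {a..b} \<inter> T \<Longrightarrow> 0 \<le> h s"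
  shows "0 \<le> diamond_integral T \<alpha> a b h"
  unfolding diamond_integral_def delta_integral_def nabla_integral_def set_lebesgue_integral_def
  using assms
  by (intro add_nonneg_nonneg mult_nonneg_nonneg integral_nonneg) (auto simp: indicator_def)

text \<open>For fixed r the numbers \<open>c i * v i r\<close> are constants, so integrating in s
  leaves a finite linear combination of the functions \<open>v i\<close>. It is nonnegative in r,
  and integrating it once more gives the claim.\<close>

lemma diamond_integral_bilinear_nonneg:
  assumes \<alpha>: "0 \<le> \<alpha>" "\<alpha> \<le> 1"
    and u: "\<And>i. i \<in> J \<Longrightarrow> diamond_integrable T a b (u i)"
    and v: "\<And>i. i \<in> J \<Longrightarrow> diamond_integrable T a b (v i)"
    and nonneg: "\<And>s r. s \<in> {a..b} \<inter> T \<Longrightarrow> r \<in> {a..b} \<inter> T \<Longrightarrow> 0 \<le> (\<Sum>i\<in>J. c i * u i s * v i r)"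
  shows "0 \<le> (\<Sum>i\<in>J. c i * diamond_integral T \<alpha> a b (u i) * diamond_integral T \<alpha> a b (v i))"
proof -
  let ?I = "diamond_integral T \<alpha> a b"
  have "0 \<le> (\<Sum>i\<in>J. c i * ?I (u i) * v i r)" if r: "r \<in> {a..b} \<inter> T" for r
  proof -
    have "0 \<le> ?I (\<lambda>s. \<Sum>i\<in>J. (c i * v i r) * u i s)"
      using \<alpha> nonneg r by (intro diamond_integral_nonneg) (auto simp: mult_ac)
    also have "?I (\<lambda>s. \<Sum>i\<in>J. (c i * v i r) * u i s) = (\<Sum>i\<in>J. (c i * v i r) * ?I (u i))"
      by (rule diamond_integral_sum[OF u])
    finally show ?thesis
      by (simp add: mult_ac)
  qed
  then have "0 \<le> ?I (\<lambda>r. \<Sum>i\<in>J. (c i * ?I (u i)) * v i r)"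
    using \<alpha> by (intro diamond_integral_nonneg) auto
  then show ?thesis
    by (simp add: diamond_integral_sum v)
qed

text \<open>Expanding the square turns the two bounds into two weighted AM-GM inequalities. In the
  lower one, P is the geometric mean of x^2 and x y with weights 1 - 2 \<delta> and 2 \<delta>. In
  the upper one, x y is a geometric mean of y^2 and P. The bound \<delta> \<le> 1/2 makes the
  weights nonnegative.\<close>

lemma Young_refinement_half:
  fixes x y \<delta> :: real
  assumes x: "0 \<le> x" and y: "0 \<le> y" and \<delta>: "0 \<le> \<delta>" "\<delta> \<le> 1/2"
  defines "P \<equiv> rpow x (2 * (1 - \<delta>)) * rpow y (2 * \<delta>)"
  shows "\<delta> * (x - y)\<^sup>2 \<le> (1 - \<delta>) * x\<^sup>2 + \<delta> * y\<^sup>2 - P"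
    and "(1 - \<delta>) * x\<^sup>2 + \<delta> * y\<^sup>2 - P \<le> (1 - \<delta>) * (x - y)\<^sup>2"
proof -
  have "P \<le> (1 - 2 * \<delta>) * x\<^sup>2 + 2 * \<delta> * (x * y) \<and> 2 * (1 - \<delta>) * (x * y) \<le> (1 - 2 * \<delta>) * y\<^sup>2 + P"
  proof (cases "x = 0 \<or> y = 0")
    \<comment> \<open>If \<delta> = 0, then P = x^2, because \<open>rpow y 0 = 1\<close> even at y =
      0. If \<delta> > 0, both exponents are positive and P = 0.\<close>
    case True
    then show ?thesis
      using \<delta> x y by (cases "\<delta> = 0") (auto simp: P_def rpow_two, auto simp: rpow_def)
  next
    case False
    then have pos: "x > 0" "y > 0" using x y by auto
    have sq: "z\<^sup>2 = z powr 2" if "z > 0" for z :: real using that by simp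
    \<comment> \<open>For positive bases \<open>rpow\<close> and \<open>powr\<close> agree, also at
      exponent 0.\<close>
    have P: "P = x powr (2 * (1 - \<delta>)) * y powr (2 * \<delta>)"
      using \<delta> pos by (auto simp: P_def rpow_def)
    have "(x\<^sup>2) powr (1 - 2 * \<delta>) * (x * y) powr (2 * \<delta>) = P"
    proof -
      have "(x\<^sup>2) powr (1 - 2 * \<delta>) * (x * y) powr (2 * \<delta>)
          = x powr (2 * (1 - 2 * \<delta>)) * x powr (2 * \<delta>) * y powr (2 * \<delta>)"
        using sq[OF pos(1)] pos by (simp only: powr_powr powr_mult mult.assoc)
      also have "\<dots> = x powr (2 * (1 - 2 * \<delta>) + 2 * \<delta>) * y powr (2 * \<delta>)"
        by (simp only: powr_add)
      also have "2 * (1 - 2 * \<delta>) + 2 * \<delta> = 2 * (1 - \<delta>)" by simp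
      finally show ?thesis by (simp only: P)
    qed
    moreover have "(x\<^sup>2) powr (1 - 2 * \<delta>) * (x * y) powr (2 * \<delta>)
        \<le> (1 - 2 * \<delta>) * x\<^sup>2 + 2 * \<delta> * (x * y)"
      using pos \<delta> by (intro Youngs_inequality_0) auto
    moreover have "2 * (1 - \<delta>) * (x * y) \<le> (1 - 2 * \<delta>) * y\<^sup>2 + P"
    proof -
      \<comment> \<open>m is the exponent of x in P, so \<open>P powr (1 / m)\<close> contains x to
        the first power. The weights (m - 1)/m and 1/m then bring the total exponent of y to 1 as
        well, and multiplying by m clears the denominators.\<close>
      define m where "m = 2 * (1 - \<delta>)"
      have m: "m > 0" "1 - 2 * \<delta> = m - 1" "m \<ge> 1" "2 * \<delta> = 2 - m" using \<delta> by (auto simp: m_def)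
      have Px: "P = x powr m * y powr (2 - m)" unfolding P m_def by simp
      have "(y\<^sup>2) powr ((m - 1) / m) * P powr (1 / m) \<le> (m - 1) / m * y\<^sup>2 + 1 / m * P"
        using pos m by (intro Youngs_inequality_0) (auto simp: Px field_simps)
      moreover have "(y\<^sup>2) powr ((m - 1) / m) * P powr (1 / m) = x * y powr (2 * ((m - 1) / m) + (2 - m) / m)"
      proof -
        have "P powr (1 / m) = x powr (m * (1 / m)) * y powr ((2 - m) * (1 / m))"
          unfolding Px using pos by (simp only: powr_mult powr_powr powr_ge_zero)
        also have "\<dots> = x * y powr ((2 - m) / m)" using pos m by simp
        finally show ?thesis using sq[OF pos(2)] by (simp only: powr_powr powr_add mult_ac)
      qed
      moreover have "2 * ((m - 1) / m) + (2 - m) / m = 1"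
        using m by (simp add: field_simps)
      ultimately have "x * y \<le> (m - 1) / m * y\<^sup>2 + 1 / m * P" using pos by simp
      then have "m * (x * y) \<le> m * ((m - 1) / m * y\<^sup>2 + 1 / m * P)" using m by simp
      also have "\<dots> = (m - 1) * y\<^sup>2 + P" using m by (simp add: field_simps)
      finally show ?thesis unfolding m(2) m_def[symmetric] .
    qed
    ultimately show ?thesis by simp
  qed
  then show "\<delta> * (x - y)\<^sup>2 \<le> (1 - \<delta>) * x\<^sup>2 + \<delta> * y\<^sup>2 - P"
    and "(1 - \<delta>) * x\<^sup>2 + \<delta> * y\<^sup>2 - P \<le> (1 - \<delta>) * (x - y)\<^sup>2"
    by (simp_all add: power2_eq_square algebra_simps)
qed

text \<open>Exchanging x with y and \<delta> with 1 - \<delta> changes neither P, nor the middle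
  expression, nor (x - y)^2, so the case \<delta> > 1/2 follows from the other half.\<close>

lemma Young_refinement:
  fixes x y \<delta> :: real
  assumes "0 \<le> x" and "0 \<le> y" and "0 \<le> \<delta>" "\<delta> \<le> 1"
  defines "P \<equiv> rpow x (2 * (1 - \<delta>)) * rpow y (2 * \<delta>)"
  shows "min (1 - \<delta>) \<delta> * (x - y)\<^sup>2 \<le> (1 - \<delta>) * x\<^sup>2 + \<delta> * y\<^sup>2 - P"
    and "(1 - \<delta>) * x\<^sup>2 + \<delta> * y\<^sup>2 - P \<le> max (1 - \<delta>) \<delta> * (x - y)\<^sup>2"
proof -
  have "min (1 - \<delta>) \<delta> * (x - y)\<^sup>2 \<le> (1 - \<delta>) * x\<^sup>2 + \<delta> * y\<^sup>2 - P
    \<and> (1 - \<delta>) * x\<^sup>2 + \<delta> * y\<^sup>2 - P \<le> max (1 - \<delta>) \<delta> * (x - y)\<^sup>2"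
  proof (cases "\<delta> \<le> 1/2")
    case True
    then have "min (1 - \<delta>) \<delta> = \<delta>" "max (1 - \<delta>) \<delta> = 1 - \<delta>" by auto
    then show ?thesis
      using Young_refinement_half[of x y \<delta>] True assms by simp
  next
    case False
    then have "min (1 - \<delta>) \<delta> = 1 - \<delta>" "max (1 - \<delta>) \<delta> = \<delta>" by auto
    then show ?thesis
      using Young_refinement_half[of y x "1 - \<delta>"] False assms(1-4)
      by (simp add: P_def power2_commute[of y x] mult.commute add.commute)
  qed
  then show "min (1 - \<delta>) \<delta> * (x - y)\<^sup>2 \<le> (1 - \<delta>) * x\<^sup>2 + \<delta> * y\<^sup>2 - P"
    and "(1 - \<delta>) * x\<^sup>2 + \<delta> * y\<^sup>2 - P \<le> max (1 - \<delta>) \<delta> * (x - y)\<^sup>2"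
    by blast+
qed

theorem theorem3p1:
  fixes T :: "real set" and a b t \<alpha> \<delta> \<beta> \<gamma> :: real
    and w f g :: "real \<Rightarrow> real" and K :: "real \<Rightarrow> real \<Rightarrow> real"
  assumes "time_scale T" and "a \<in> T" and "b \<in> T" and "a < b"
    and "t \<in> {a<..b} \<inter> T"
    and "0 \<le> \<alpha>" and "\<alpha> \<le> 1"
    and "continuous_on ({a..b} \<inter> T) w" and "diamond_integrable T a b w"
    and "continuous_on ({a..b} \<inter> T) f" and "diamond_integrable T a b f"
    and "continuous_on ({a..b} \<inter> T) g" and "diamond_integrable T a b g"
    and "\<And>x y. x \<in> {a..b} \<inter> T \<Longrightarrow> y \<in> {a..b} \<inter> T \<Longrightarrow> 0 \<le> K x y"
    and "0 \<le> \<delta>" and "\<delta> \<le> 1"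
    and "\<beta> = min (1 - \<delta>) \<delta>" and "\<gamma> = max (1 - \<delta>) \<delta>"
    and "kernel_integrable T a K (\<lambda>s. \<bar>w s\<bar> * \<bar>f s\<bar>^2) t"
    and "kernel_integrable T a K (\<lambda>s. \<bar>w s\<bar> * \<bar>g s\<bar>^2) t"
    and "kernel_integrable T a K (\<lambda>s. \<bar>w s\<bar> * \<bar>f s\<bar> * \<bar>g s\<bar>) t"
    and "kernel_integrable T a K
           (\<lambda>s. \<bar>w s\<bar> * rpow \<bar>f s\<bar> (2 * (1 - \<delta>)) * rpow \<bar>g s\<bar> (2 * \<delta>)) t"
    and "kernel_integrable T a K
           (\<lambda>s. \<bar>w s\<bar> * rpow \<bar>f s\<bar> (2 * \<delta>) * rpow \<bar>g s\<bar> (2 * (1 - \<delta>))) t"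
  shows "2 * \<beta> *
           (kernel_operator T \<alpha> a K (\<lambda>s. \<bar>w s\<bar> * \<bar>f s\<bar>^2) t
              * kernel_operator T \<alpha> a K (\<lambda>s. \<bar>w s\<bar> * \<bar>g s\<bar>^2) t
            - (kernel_operator T \<alpha> a K (\<lambda>s. \<bar>w s\<bar> * \<bar>f s\<bar> * \<bar>g s\<bar>) t)^2)
         \<le> kernel_operator T \<alpha> a K (\<lambda>s. \<bar>w s\<bar> * \<bar>f s\<bar>^2) t
              * kernel_operator T \<alpha> a K (\<lambda>s. \<bar>w s\<bar> * \<bar>g s\<bar>^2) t
            - kernel_operator T \<alpha> a K
                (\<lambda>s. \<bar>w s\<bar> * rpow \<bar>f s\<bar> (2 * (1 - \<delta>)) * rpow \<bar>g s\<bar> (2 * \<delta>)) t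
              * kernel_operator T \<alpha> a K
                (\<lambda>s. \<bar>w s\<bar> * rpow \<bar>f s\<bar> (2 * \<delta>) * rpow \<bar>g s\<bar> (2 * (1 - \<delta>))) t
       \<and> kernel_operator T \<alpha> a K (\<lambda>s. \<bar>w s\<bar> * \<bar>f s\<bar>^2) t
              * kernel_operator T \<alpha> a K (\<lambda>s. \<bar>w s\<bar> * \<bar>g s\<bar>^2) t
            - kernel_operator T \<alpha> a K
                (\<lambda>s. \<bar>w s\<bar> * rpow \<bar>f s\<bar> (2 * (1 - \<delta>)) * rpow \<bar>g s\<bar> (2 * \<delta>)) t
              * kernel_operator T \<alpha> a K
                (\<lambda>s. \<bar>w s\<bar> * rpow \<bar>f s\<bar> (2 * \<delta>) * rpow \<bar>g s\<bar> (2 * (1 - \<delta>))) t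
         \<le> 2 * \<gamma> *
           (kernel_operator T \<alpha> a K (\<lambda>s. \<bar>w s\<bar> * \<bar>f s\<bar>^2) t
              * kernel_operator T \<alpha> a K (\<lambda>s. \<bar>w s\<bar> * \<bar>g s\<bar>^2) t
            - (kernel_operator T \<alpha> a K (\<lambda>s. \<bar>w s\<bar> * \<bar>f s\<bar> * \<bar>g s\<bar>) t)^2)"
proof -
  define k where "k s = K t s * \<bar>w s\<bar>" for s
  define F where "F s = K t s * (\<bar>w s\<bar> * \<bar>f s\<bar>^2)" for s
  define G where "G s = K t s * (\<bar>w s\<bar> * \<bar>g s\<bar>^2)" for s
  define H where "H s = K t s * (\<bar>w s\<bar> * \<bar>f s\<bar> * \<bar>g s\<bar>)" for s
  define D where
    "D s = K t s * (\<bar>w s\<bar> * rpow \<bar>f s\<bar> (2 * (1 - \<delta>)) * rpow \<bar>g s\<bar> (2 * \<delta>))" for s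
  define E where
    "E s = K t s * (\<bar>w s\<bar> * rpow \<bar>f s\<bar> (2 * \<delta>) * rpow \<bar>g s\<bar> (2 * (1 - \<delta>)))" for s
  note kernel_defs = F_def G_def H_def D_def E_def
  have int: "diamond_integrable T a t F" "diamond_integrable T a t G" "diamond_integrable T a t H"
    "diamond_integrable T a t D" "diamond_integrable T a t E"
    using assms(19-23) unfolding kernel_integrable_def kernel_defs[abs_def] by simp_all
  let ?I = "diamond_integral T \<alpha> a t"
  have k: "0 \<le> k s" if "s \<in> {a..t} \<inter> T" for s
    using assms(5,14) that by (auto simp: k_def)
  \<comment> \<open>The middle expression is not symmetric in s and r. Integration sends both
    \<open>F s * G r\<close> and \<open>G s * F r\<close> to \<open>?I F * ?I G\<close>: the weights
    1 - \<delta> and \<delta> then add up to 1, and the outer expressions acquire their factor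
    2.\<close>
  have pw: "\<beta> * (F s * G r + G s * F r - 2 * (H s * H r))
        \<le> (1 - \<delta>) * (F s * G r) + \<delta> * (G s * F r) - D s * E r
      \<and> (1 - \<delta>) * (F s * G r) + \<delta> * (G s * F r) - D s * E r
        \<le> \<gamma> * (F s * G r + G s * F r - 2 * (H s * H r))"
    if "s \<in> {a..t} \<inter> T" "r \<in> {a..t} \<inter> T" for s r
  proof -
    define x y where "x = \<bar>f s\<bar> * \<bar>g r\<bar>" and "y = \<bar>f r\<bar> * \<bar>g s\<bar>"
    define P where "P = rpow x (2 * (1 - \<delta>)) * rpow y (2 * \<delta>)"
    define \<kappa> where "\<kappa> = k s * k r"
    have \<kappa>: "0 \<le> \<kappa>" using k that by (simp add: \<kappa>_def)
    \<comment> \<open>In \<open>D s * E r\<close> the powers of f at s and g at r share the exponent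
      2 (1 - \<delta>), those of g at s and f at r share 2 \<delta>; \<open>rpow_mult\<close>
      collects them into powers of x and y.\<close>
    have e: "F s * G r = \<kappa> * x\<^sup>2" "G s * F r = \<kappa> * y\<^sup>2" "H s * H r = \<kappa> * (x * y)"
      "D s * E r = \<kappa> * P"
      by (simp_all add: kernel_defs \<kappa>_def k_def x_def y_def P_def rpow_mult power_mult_distrib mult_ac)
    have xy: "0 \<le> x" "0 \<le> y" by (simp_all add: x_def y_def)
    have "\<kappa> * (\<beta> * (x - y)\<^sup>2) \<le> \<kappa> * ((1 - \<delta>) * x\<^sup>2 + \<delta> * y\<^sup>2 - P)"
      "\<kappa> * ((1 - \<delta>) * x\<^sup>2 + \<delta> * y\<^sup>2 - P) \<le> \<kappa> * (\<gamma> * (x - y)\<^sup>2)"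
      using Young_refinement[OF xy assms(15,16)] \<kappa>
      by (simp_all add: P_def assms(17,18) mult_left_mono)
    then show ?thesis
      unfolding e by (simp add: power2_eq_square algebra_simps)
  qed
  \<comment> \<open>The products \<open>u i s * v i r\<close> run through the four terms of
    \<open>pw\<close>, with s always in the first factor.\<close>
  define u v where "u = (!) [F, G, H, D]" and "v = (!) [G, F, H, E]"
  have uv: "diamond_integrable T a t (u i)" "diamond_integrable T a t (v i)" if "i \<in> {..<4}" for i
    using that int by (auto simp: u_def v_def less_Suc_eq numeral_eq_Suc)
  have sum4: "(\<Sum>i<4. h i) = h 0 + h 1 + h 2 + h 3" for h :: "nat \<Rightarrow> real"
    by (simp add: eval_nat_numeral)
  \<comment> \<open>The list holds the coefficients of the lower half of \<open>pw\<close> after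
    moving everything to one side; the list with \<gamma> below does the same for the upper
    half.\<close>
  have "0 \<le> (\<Sum>i<4. [1 - \<delta> - \<beta>, \<delta> - \<beta>, 2 * \<beta>, - 1] ! i * ?I (u i) * ?I (v i))"
  proof (rule diamond_integral_bilinear_nonneg[OF assms(6,7) uv])
    fix s r assume "s \<in> {a..t} \<inter> T" "r \<in> {a..t} \<inter> T"
    from pw[OF this] show "0 \<le> (\<Sum>i<4. [1 - \<delta> - \<beta>, \<delta> - \<beta>, 2 * \<beta>, - 1] ! i * u i s * v i r)"
      by (simp add: sum4 u_def v_def algebra_simps)
  qed
  moreover have "0 \<le> (\<Sum>i<4. [\<gamma> - (1 - \<delta>), \<gamma> - \<delta>, - 2 * \<gamma>, 1] ! i * ?I (u i) * ?I (v i))"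
  proof (rule diamond_integral_bilinear_nonneg[OF assms(6,7) uv])
    fix s r assume "s \<in> {a..t} \<inter> T" "r \<in> {a..t} \<inter> T"
    from pw[OF this] show "0 \<le> (\<Sum>i<4. [\<gamma> - (1 - \<delta>), \<gamma> - \<delta>, - 2 * \<gamma>, 1] ! i * u i s * v i r)"
      by (simp add: sum4 u_def v_def algebra_simps)
  qed
  \<comment> \<open>The first two coefficients now multiply the same product
    \<open>?I F * ?I G\<close>; their sums are 1 - 2 \<beta> and 2 \<gamma> - 1.\<close>
  ultimately have "2 * \<beta> * (?I F * ?I G - (?I H)\<^sup>2) \<le> ?I F * ?I G - ?I D * ?I E
      \<and> ?I F * ?I G - ?I D * ?I E \<le> 2 * \<gamma> * (?I F * ?I G - (?I H)\<^sup>2)"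
    by (simp add: sum4 u_def v_def power2_eq_square algebra_simps)
  then show ?thesis
    unfolding kernel_operator_def kernel_defs[abs_def] .
qed

end
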